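(* Let $n\ge 1$. The algebra map $\mathbb{Z}_2\langle x_1,\dots,x_n,s_1,\dots,s_n\rangle \to \mathrm{End}_{\mathbb{Z}_2}(\mathbb{Z}_2[\mathbb{A}^n])$ sending $x_i$ to the operator of multiplication by $x_i$, and $s_i$ to the shift operator in the $i$-direction, descends to an isomorphism $\mathrm{SBW}_n\to \mathrm{End}_{\mathbb{Z}_2}(\mathbb{Z}_2[\mathbb{A}^n])$ of $\mathbb{Z}_2$-algebras.
   Context: $\mathbb{Z}_2=\{0,1\}$ is the field with two elements and $[n]=\{1,\dots,n\}$. $\mathbb{Z}_2[\mathbb{A}^n]$ is the $\mathbb{Z}_2$-algebra (pointwise operations) of regular functions on $\mathbb{Z}_2^n$, i.e. maps $f:\mathbb{Z}_2^n\to\mathbb{Z}_2$ given by evaluating some polynomial in $\mathbb{Z}_2[x_1,\dots,x_n]$; $x_i$ also denotes the $i$-th coordinate function. The shift operator in the $i$-direction acts on $\mathbb{Z}_2[\mathbb{A}^n]$ by $(s_if)(x)=f(x+e_i)$, where $e_i\in\mathbb{Z}_2^n$ is the vector whose only nonzero entry is at position $i$. $\mathrm{End}_{\mathbb{Z}_2}$ denotes the algebra of $\mathbb{Z}_2$-linear endomorphisms with composition as product. $\mathbb{Z}_2\langle x_1,\dots,x_n,s_1,\dots,s_n\rangle$ is the free associative $\mathbb{Z}_2$-algebra on the indicated generators. The shifted Boole-Weyl algebra $\mathrm{SBW}_n$ is its quotient by the two-sided ideal generated by $x_i^2+x_i$, $s_i^2+1$, $s_ix_i+x_is_i+s_i$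 for $i\in[n]$; $x_ix_j+x_jx_i$, $s_is_j+s_js_i$ for $i,j\in[n]$; and $s_ix_j+x_js_i$ for $i\neq j\in[n]$. *)

theory Defs
  imports
    "HOL-Analysis.Finite_Cartesian_Product"
    "HOL-Library.Z2"
    "HOL-Library.Poly_Mapping"
    "HOL-Library.FuncSet"
    "HOL-Algebra.Module"
    "HOL-Algebra.QuotRing"
begin

section \<open>Associative algebras over a commutative ring\<close>

text \<open>
  The library locale \<^locale>\<open>algebra\<close> requires a commutative multiplication, so the
  not necessarily commutative, unital case is set up here.
\<close>

locale assoc_algebra = Module.module R A + A?: Ring.ring A
  for R :: "('r, 'k) ring_scheme" (structure) and A :: "('r, 'a, 'm) module_scheme" (structure) +
  assumes smult_mult_left:
      "\<lbrakk>c \<in> carrier R; x \<in> carrier A; y \<in> carrier A\<rbrakk> \<Longrightarrow>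
        (c \<odot>\<^bsub>A\<^esub> x) \<otimes>\<^bsub>A\<^esub> y = c \<odot>\<^bsub>A\<^esub> (x \<otimes>\<^bsub>A\<^esub> y)"
    and smult_mult_right:
      "\<lbrakk>c \<in> carrier R; x \<in> carrier A; y \<in> carrier A\<rbrakk> \<Longrightarrow>
        x \<otimes>\<^bsub>A\<^esub> (c \<odot>\<^bsub>A\<^esub> y) = c \<odot>\<^bsub>A\<^esub> (x \<otimes>\<^bsub>A\<^esub> y)"

locale assoc_algebra_hom = A?: assoc_algebra R A + B?: assoc_algebra R B
  for R :: "('r, 'k) ring_scheme" (structure)
    and A :: "('r, 'a, 'm) module_scheme" (structure)
    and B :: "('r, 'b, 'l) module_scheme" (structure) +
  fixes h :: "'a \<Rightarrow> 'b"
  assumes ring_hom: "h \<in> ring_hom A B"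
    and hom_smult: "\<lbrakk>c \<in> carrier R; x \<in> carrier A\<rbrakk> \<Longrightarrow> h (c \<odot>\<^bsub>A\<^esub> x) = c \<odot>\<^bsub>B\<^esub> h x"

locale assoc_algebra_iso = assoc_algebra_hom +
  assumes bij: "bij_betw h (carrier A) (carrier B)"

text \<open>
  The scalar action on cosets follows the pattern of \<^const>\<open>rcoset_mult\<close>; when \<open>I\<close> is an ideal,
  \<open>c\<close> sends the coset of \<open>x\<close> to the coset of \<open>c \<odot> x\<close>.
\<close>

definition quotient_algebra ::
    "('r, 'a, 'm) module_scheme \<Rightarrow> 'a set \<Rightarrow> ('r, 'a set) module" where
  "quotient_algebra A I =
     ring.extend (A Quot I) (module.fields (\<lambda>c C. \<Union>x\<in>C. I +>\<^bsub>A\<^esub> (c \<odot>\<^bsub>A\<^esub> x)))"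

text \<open>
  Endomorphisms are extensional functions (undefined outside the carrier), so that equal
  operators are equal as functions.
\<close>

definition endo_algebra ::
    "('r, 'k) ring_scheme \<Rightarrow> ('r, 'a, 'm) module_scheme \<Rightarrow> ('r, 'a \<Rightarrow> 'a) module" where
  "endo_algebra R M =
    \<lparr>carrier = {T \<in> carrier M \<rightarrow>\<^sub>E carrier M.
        (\<forall>x\<in>carrier M. \<forall>y\<in>carrier M. T (x \<oplus>\<^bsub>M\<^esub> y) = T x \<oplus>\<^bsub>M\<^esub> T y) \<and>
        (\<forall>c\<in>carrier R. \<forall>x\<in>carrier M. T (c \<odot>\<^bsub>M\<^esub> x) = c \<odot>\<^bsub>M\<^esub> T x)},
     mult = compose (carrier M),
     one = (\<lambda>x\<in>carrier M. x),
     zero = (\<lambda>x\<in>carrier M. \<zero>\<^bsub>M\<^esub>),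
     add = (\<lambda>T U. \<lambda>x\<in>carrier M. T x \<oplus>\<^bsub>M\<^esub> U x),
     smult = (\<lambda>c T. \<lambda>x\<in>carrier M. c \<odot>\<^bsub>M\<^esub> T x)\<rparr>"


section \<open>The field with two elements and free algebras over it\<close>

definition Z2 :: "bit ring" where
  "Z2 = \<lparr>carrier = UNIV, mult = (*), one = 1, zero = 0, add = (+)\<rparr>"

text \<open>
  Words under concatenation form the free monoid. It is written additively because the
  convolution product on \<^type>\<open>poly_mapping\<close> is based on the additive operation of
  the index type; the resulting monoid is not commutative.
\<close>

datatype 'g word = Word (letters: "'g list")

instantiation word :: (type) monoid_add
begin

definition zero_word :: "'a word" where
  "0 = Word []"

definition plus_word :: "'a word \<Rightarrow> 'a word \<Rightarrow> 'a word" where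
  "u + v = Word (letters u @ letters v)"

instance
  by standard (simp_all add: zero_word_def plus_word_def)

end

definition free_algebra :: "(bit, 'g word \<Rightarrow>\<^sub>0 bit) module" where
  "free_algebra =
    \<lparr>carrier = UNIV, mult = (*), one = 1, zero = 0, add = (+),
     smult = (\<lambda>c. Poly_Mapping.map ((*) c))\<rparr>"

definition gen :: "'g \<Rightarrow> 'g word \<Rightarrow>\<^sub>0 bit" where
  "gen g = Poly_Mapping.single (Word [g]) 1"


section \<open>Regular functions on affine space\<close>

text \<open>
  The index set is a finite (hence nonempty) type \<open>'n\<close>, and a polynomial is a finitely
  supported function from exponent vectors to coefficients.
\<close>

definition eval_poly :: "(('n::finite \<Rightarrow>\<^sub>0 nat) \<Rightarrow>\<^sub>0 bit) \<Rightarrow> bit ^ 'n \<Rightarrow> bit" where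
  "eval_poly p x =
     (\<Sum>m\<in>Poly_Mapping.keys p. Poly_Mapping.lookup p m * (\<Prod>i\<in>UNIV. x $ i ^ Poly_Mapping.lookup m i))"

definition regular_functions :: "(bit, bit ^ 'n::finite \<Rightarrow> bit) module" where
  "regular_functions =
    \<lparr>carrier = range eval_poly,
     mult = (\<lambda>f g x. f x * g x), one = (\<lambda>x. 1), zero = (\<lambda>x. 0), add = (\<lambda>f g x. f x + g x),
     smult = (\<lambda>c f x. c * f x)\<rparr>"

definition coord :: "'n::finite \<Rightarrow> bit ^ 'n \<Rightarrow> bit" where
  "coord i = (\<lambda>x. x $ i)"

definition mult_op :: "'n::finite \<Rightarrow> (bit ^ 'n \<Rightarrow> bit) \<Rightarrow> (bit ^ 'n \<Rightarrow> bit)" where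
  "mult_op i = (\<lambda>f\<in>carrier regular_functions. coord i \<otimes>\<^bsub>regular_functions\<^esub> f)"

definition shift_op :: "'n::finite \<Rightarrow> (bit ^ 'n \<Rightarrow> bit) \<Rightarrow> (bit ^ 'n \<Rightarrow> bit)" where
  "shift_op i = (\<lambda>f\<in>carrier regular_functions. \<lambda>x. f (x + axis i 1))"


section \<open>The shifted Boole-Weyl algebra\<close>

datatype 'n sbw_gen = Xgen 'n | Sgen 'n

definition sbw_relations :: "('n::finite sbw_gen word \<Rightarrow>\<^sub>0 bit) set" where
  "sbw_relations =
     (\<Union>i. {gen (Xgen i) ^ 2 + gen (Xgen i),
           gen (Sgen i) ^ 2 + 1,
           gen (Sgen i) * gen (Xgen i) + gen (Xgen i) * gen (Sgen i) + gen (Sgen i)}) \<union>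
     (\<Union>i. \<Union>j. {gen (Xgen i) * gen (Xgen j) + gen (Xgen j) * gen (Xgen i),
               gen (Sgen i) * gen (Sgen j) + gen (Sgen j) * gen (Sgen i)}) \<union>
     {gen (Sgen i) * gen (Xgen j) + gen (Xgen j) * gen (Sgen i) | i j. i \<noteq> j}"

definition sbw_ideal :: "('n::finite sbw_gen word \<Rightarrow>\<^sub>0 bit) set" where
  "sbw_ideal = Idl\<^bsub>free_algebra\<^esub> sbw_relations"

definition SBW :: "(bit, ('n::finite sbw_gen word \<Rightarrow>\<^sub>0 bit) set) module" where
  "SBW = quotient_algebra free_algebra sbw_ideal"

text \<open>
  By freeness, exactly one map satisfies this predicate; this is asserted as part of the main
  theorem rather than built into a definition by evaluation.
\<close>

definition sbw_action ::
    "(('n::finite sbw_gen word \<Rightarrow>\<^sub>0 bit) \<Rightarrow> (bit ^ 'n \<Rightarrow> bit) \<Rightarrow> (bit ^ 'n \<Rightarrow> bit)) \<Rightarrow> bool" where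
  "sbw_action \<phi> \<longleftrightarrow>
     assoc_algebra_hom Z2 free_algebra (endo_algebra Z2 regular_functions) \<phi> \<and>
     (\<forall>i. \<phi> (gen (Xgen i)) = mult_op i) \<and> (\<forall>i. \<phi> (gen (Sgen i)) = shift_op i)"

end

theory Submission
  imports Defs
begin

text \<open>
  Write $V$ for the functions $\mathbb{Z}_2^n \to \mathbb{Z}_2$, every one of which is regular.
  The operators are easy to understand in the form
  $f \mapsto \bigl(x \mapsto \sum_b G(x, b)\, f(x + b)\bigr)$: each endomorphism of $V$ has this
  form for exactly one kernel $G$, because $G(x, b)$ is its value on the indicator function of
  $x + b$, taken at $x$.

  On the side of the algebra, the relations let one move every shift to the right of every
  coordinate, sort the coordinates and the shifts, and cancel repetitions. So every element is
  congruent to a combination $\sum F(a, b)\, x^a s^b$ of the $4^n$ monomials with exponents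
  $a, b \in \{0, 1\}^n$ (\<open>every_has_normal_form\<close>); since words
  are built up letter by letter, this comes down to rewriting a generator times a monomial.

  Such a combination acts with the kernel $G(x, b) = \sum_a F(a, b)\, x^a$ (\<open>action_normal_form\<close>).
  The passage from coefficients $F({-}, b)$ to functions $G({-}, b)$ is the Reed-Muller transform,
  a bijection: it is unitriangular with respect to inclusion of supports, hence injective, and it
  maps a finite set to itself. Hence the normal forms biject with the endomorphisms of $V$.
  Surjectivity of the action follows at once, and so does injectivity modulo the relations: an
  element of the kernel of the action is congruent to a normal form that acts as zero, hence to zero
  (\<open>kernel_eq_sbw_ideal\<close>). The first isomorphism theorem finishes the proof.

  Surjectivity of the Reed-Muller transform also says that every function is a polynomial function,
  which identifies the carrier of the module of regular functions (\<open>eval_poly_surj\<close>).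
\<close>

section \<open>Quotients and endomorphisms of associative algebras\<close>

text \<open>
  The scalar action of a quotient algebra is added to the record of the quotient ring, so the ring
  axioms have to be carried over to the extended record.
\<close>

lemma ring_extend_ring:
  assumes "ring S"
  shows "ring (ring.extend S m)"
proof -
  interpret S: ring S by fact
  show ?thesis
  proof (intro ringI abelian_groupI monoidI)
    show "\<exists>y\<in>carrier (ring.extend S m).
        y \<oplus>\<^bsub>ring.extend S m\<^esub> x = \<zero>\<^bsub>ring.extend S m\<^esub>"
      if "x \<in> carrier (ring.extend S m)" for x
      using that S.add.l_inv_ex by (simp add: ring.defs)
  qed (simp_all add: ring.defs S.a_ac S.m_assoc S.l_distr S.r_distr)
qed

context assoc_algebra
begin

text \<open>
  A two-sided ideal is a submodule because scalars act through $c \cdot 1$; this makes the scalar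
  action on cosets well defined.
\<close>

lemma ideal_smult_closed:
  assumes "ideal I A" "c \<in> carrier R" "x \<in> I"
  shows "c \<odot>\<^bsub>A\<^esub> x \<in> I"
proof -
  interpret I: ideal I A by fact
  have x: "x \<in> carrier A" by (rule I.a_Hcarr[OF assms(3)])
  have "(c \<odot>\<^bsub>A\<^esub> \<one>\<^bsub>A\<^esub>) \<otimes>\<^bsub>A\<^esub> x \<in> I"
    by (rule I.I_l_closed) (use assms in auto)
  with x assms(2) show ?thesis by (simp add: smult_mult_left)
qed

lemma quotient_algebra_smult:
  assumes "ideal I A" "c \<in> carrier R" "x \<in> carrier A"
  shows "c \<odot>\<^bsub>quotient_algebra A I\<^esub> (I +>\<^bsub>A\<^esub> x) = I +>\<^bsub>A\<^esub> (c \<odot>\<^bsub>A\<^esub> x)"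
proof -
  interpret I: ideal I A by fact
  have eq: "I +>\<^bsub>A\<^esub> (c \<odot>\<^bsub>A\<^esub> y) = I +>\<^bsub>A\<^esub> (c \<odot>\<^bsub>A\<^esub> x)" if "y \<in> I +>\<^bsub>A\<^esub> x" for y
  proof -
    from that obtain h where h: "h \<in> I" and y: "y = h \<oplus>\<^bsub>A\<^esub> x"
      by (auto simp: a_r_coset_def r_coset_def)
    have hc: "h \<in> carrier A" by (rule I.a_Hcarr[OF h])
    have "c \<odot>\<^bsub>A\<^esub> y = c \<odot>\<^bsub>A\<^esub> h \<oplus>\<^bsub>A\<^esub> c \<odot>\<^bsub>A\<^esub> x"
      using y hc assms by (simp add: smult_r_distr)
    moreover have "c \<odot>\<^bsub>A\<^esub> h \<in> I"
      by (rule ideal_smult_closed[OF assms(1,2) h])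
    ultimately have "c \<odot>\<^bsub>A\<^esub> y \<in> I +>\<^bsub>A\<^esub> (c \<odot>\<^bsub>A\<^esub> x)"
      by (auto simp: a_r_coset_def r_coset_def)
    then show ?thesis
      using M.a_repr_independence[OF _ smult_closed[OF assms(2,3)] I.a_subgroup] by simp
  qed
  moreover have "x \<in> I +>\<^bsub>A\<^esub> x" by (rule I.a_rcos_self[OF assms(3)])
  ultimately have "(\<Union>y\<in>I +>\<^bsub>A\<^esub> x. I +>\<^bsub>A\<^esub> (c \<odot>\<^bsub>A\<^esub> y)) = I +>\<^bsub>A\<^esub> (c \<odot>\<^bsub>A\<^esub> x)"
    by blast
  then show ?thesis
    by (simp add: quotient_algebra_def ring.defs module.defs)
qed

lemma quotient_algebra_carrier:
  "carrier (quotient_algebra A I) = (+>\<^bsub>A\<^esub>) I ` carrier A"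
  by (auto simp: quotient_algebra_def FactRing_def A_RCOSETS_def' ring.defs)

lemma quotient_algebra_ops:
  assumes "ideal I A" "x \<in> carrier A" "y \<in> carrier A"
  shows "(I +>\<^bsub>A\<^esub> x) \<oplus>\<^bsub>quotient_algebra A I\<^esub> (I +>\<^bsub>A\<^esub> y) = I +>\<^bsub>A\<^esub> (x \<oplus>\<^bsub>A\<^esub> y)"
    and "(I +>\<^bsub>A\<^esub> x) \<otimes>\<^bsub>quotient_algebra A I\<^esub> (I +>\<^bsub>A\<^esub> y) = I +>\<^bsub>A\<^esub> (x \<otimes>\<^bsub>A\<^esub> y)"
proof -
  interpret I: ideal I A by fact
  show "(I +>\<^bsub>A\<^esub> x) \<oplus>\<^bsub>quotient_algebra A I\<^esub> (I +>\<^bsub>A\<^esub> y) = I +>\<^bsub>A\<^esub> (x \<oplus>\<^bsub>A\<^esub> y)"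
    "(I +>\<^bsub>A\<^esub> x) \<otimes>\<^bsub>quotient_algebra A I\<^esub> (I +>\<^bsub>A\<^esub> y) = I +>\<^bsub>A\<^esub> (x \<otimes>\<^bsub>A\<^esub> y)"
    using assms by (simp_all add: quotient_algebra_def FactRing_def ring.defs
        I.a_rcos_sum I.rcoset_mult_add)
qed

lemma quotient_assoc_algebra:
  assumes I: "ideal I A"
  shows "assoc_algebra R (quotient_algebra A I)"
proof -
  interpret I: ideal I A by fact
  have ring: "ring (quotient_algebra A I)"
    unfolding quotient_algebra_def by (rule ring_extend_ring[OF I.quotient_is_ring])
  note [simp] = quotient_algebra_smult[OF I] quotient_algebra_ops[OF I]
  have "module R (quotient_algebra A I)"
  proof (rule moduleI)
    show "cring R" ..
    show "abelian_group (quotient_algebra A I)" using ring by (rule ring.is_abelian_group)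
  qed (auto simp: quotient_algebra_carrier smult_l_distr smult_r_distr smult_assoc1)
  then show ?thesis
    using ring
    by (intro assoc_algebra.intro assoc_algebra_axioms.intro)
       (auto simp: quotient_algebra_carrier smult_mult_left smult_mult_right)
qed

end

lemma (in assoc_algebra_hom) ring_hom_ring: "ring_hom_ring A B h"
  by (intro ring_hom_ringI2 ring_hom assoc_algebra.axioms(2)[OF A.assoc_algebra_axioms]
      assoc_algebra.axioms(2)[OF B.assoc_algebra_axioms])

theorem (in assoc_algebra_hom) first_isomorphism:
  assumes surj: "h ` carrier A = carrier B"
  defines "K \<equiv> a_kernel A B h"
  shows "\<exists>\<psi>. assoc_algebra_iso R (quotient_algebra A K) B \<psi> \<and>
    (\<forall>x\<in>carrier A. \<psi> (K +>\<^bsub>A\<^esub> x) = h x)"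
proof -
  interpret H: ring_hom_ring A B h by (rule ring_hom_ring)
  note A = A.assoc_algebra_axioms
  have K: "ideal K A" unfolding K_def by (rule H.kernel_is_ideal)
  let ?\<psi> = "\<lambda>X. the_elem (h ` X)"
  have \<psi>: "?\<psi> (K +>\<^bsub>A\<^esub> x) = h x" if "x \<in> carrier A" for x
    using that unfolding K_def by simp
  have iso: "?\<psi> \<in> ring_iso (A Quot K) B"
    unfolding K_def by (rule H.FactRing_iso_set[OF surj])
  have "assoc_algebra_iso R (quotient_algebra A K) B ?\<psi>"
  proof (intro assoc_algebra_iso.intro assoc_algebra_hom.intro
      assoc_algebra_hom_axioms.intro assoc_algebra_iso_axioms.intro)
    show "assoc_algebra R (quotient_algebra A K)" by (rule assoc_algebra.quotient_assoc_algebra[OF A K])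
    show "assoc_algebra R B" by (rule B.assoc_algebra_axioms)
    show "?\<psi> \<in> ring_hom (quotient_algebra A K) B"
      using iso by (simp add: ring_iso_def ring_hom_def quotient_algebra_def ring.defs)
    show "bij_betw ?\<psi> (carrier (quotient_algebra A K)) (carrier B)"
      using iso by (simp add: ring_iso_def quotient_algebra_def ring.defs)
    show "?\<psi> (c \<odot>\<^bsub>quotient_algebra A K\<^esub> X) = c \<odot>\<^bsub>B\<^esub> ?\<psi> X"
      if c: "c \<in> carrier R" and X: "X \<in> carrier (quotient_algebra A K)" for c X
    proof -
      from X obtain x where x: "x \<in> carrier A" and "X = K +>\<^bsub>A\<^esub> x"
        by (auto simp: assoc_algebra.quotient_algebra_carrier[OF A])
      with c show ?thesis
        by (simp add: assoc_algebra.quotient_algebra_smult[OF A K] \<psi> hom_smult)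
    qed
  qed
  with \<psi> show ?thesis by blast
qed

text \<open>
  Since endomorphisms are extensional, every algebra law reduces to the corresponding law of the
  module at a single element; commutativity of the scalars enters in the closure of the
  endomorphisms under scalar multiplication.
\<close>

lemma (in Module.module) endo_assoc_algebra: "assoc_algebra R (endo_algebra R M)"
proof -
  let ?E = "endo_algebra R M"
  have mem: "T x \<in> carrier M" if "T \<in> carrier ?E" "x \<in> carrier M" for T x
    using that by (auto simp: endo_algebra_def)
  have eqI: "T = U"
    if "T \<in> carrier ?E" "U \<in> carrier ?E" "\<And>x. x \<in> carrier M \<Longrightarrow> T x = U x" for T U
    using that by (intro PiE_ext) (auto simp: endo_algebra_def)
  have add: "T (x \<oplus>\<^bsub>M\<^esub> y) = T x \<oplus>\<^bsub>M\<^esub> T y"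
    if "T \<in> carrier ?E" "x \<in> carrier M" "y \<in> carrier M" for T x y
    using that by (auto simp: endo_algebra_def)
  have smult: "T (c \<odot>\<^bsub>M\<^esub> x) = c \<odot>\<^bsub>M\<^esub> T x"
    if "T \<in> carrier ?E" "c \<in> carrier R" "x \<in> carrier M" for T c x
    using that by (auto simp: endo_algebra_def)
  have apps:
    "(T \<oplus>\<^bsub>?E\<^esub> U) x = T x \<oplus>\<^bsub>M\<^esub> U x"
    "(T \<otimes>\<^bsub>?E\<^esub> U) x = T (U x)" "(c \<odot>\<^bsub>?E\<^esub> T) x = c \<odot>\<^bsub>M\<^esub> T x"
    "\<zero>\<^bsub>?E\<^esub> x = \<zero>\<^bsub>M\<^esub>" "\<one>\<^bsub>?E\<^esub> x = x"
    if "x \<in> carrier M" for T U c x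
    using that by (auto simp: endo_algebra_def compose_def)
  have comm: "c \<odot>\<^bsub>M\<^esub> (d \<odot>\<^bsub>M\<^esub> x) = d \<odot>\<^bsub>M\<^esub> (c \<odot>\<^bsub>M\<^esub> x)"
    if "c \<in> carrier R" "d \<in> carrier R" "x \<in> carrier M" for c d x
    using that by (metis R.m_comm smult_assoc1)
  have closed:
    "\<zero>\<^bsub>?E\<^esub> \<in> carrier ?E" "\<one>\<^bsub>?E\<^esub> \<in> carrier ?E"
    "\<And>T U. T \<in> carrier ?E \<Longrightarrow> U \<in> carrier ?E \<Longrightarrow> T \<oplus>\<^bsub>?E\<^esub> U \<in> carrier ?E"
    "\<And>T U. T \<in> carrier ?E \<Longrightarrow> U \<in> carrier ?E \<Longrightarrow> T \<otimes>\<^bsub>?E\<^esub> U \<in> carrier ?E"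
    "\<And>c T. c \<in> carrier R \<Longrightarrow> T \<in> carrier ?E \<Longrightarrow> c \<odot>\<^bsub>?E\<^esub> T \<in> carrier ?E"
  proof -
    show "\<zero>\<^bsub>?E\<^esub> \<in> carrier ?E" "\<one>\<^bsub>?E\<^esub> \<in> carrier ?E"
      by (auto simp: endo_algebra_def)
    show "T \<oplus>\<^bsub>?E\<^esub> U \<in> carrier ?E" if "T \<in> carrier ?E" "U \<in> carrier ?E" for T U
      using that mem[OF that(1)] mem[OF that(2)]
      by (auto simp: endo_algebra_def smult_r_distr M.a_ac)
    show "T \<otimes>\<^bsub>?E\<^esub> U \<in> carrier ?E" if "T \<in> carrier ?E" "U \<in> carrier ?E" for T U
      using that mem[OF that(1)] mem[OF that(2)]
      by (auto simp: endo_algebra_def compose_def)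
    show "c \<odot>\<^bsub>?E\<^esub> T \<in> carrier ?E" if "c \<in> carrier R" "T \<in> carrier ?E" for c T
      using that mem[OF that(2)] by (auto simp: endo_algebra_def smult_r_distr comm)
  qed
  have abel: "abelian_group ?E"
  proof (rule abelian_groupI)
    show "\<exists>U\<in>carrier ?E. U \<oplus>\<^bsub>?E\<^esub> T = \<zero>\<^bsub>?E\<^esub>" if T: "T \<in> carrier ?E" for T
    proof
      show U: "(\<ominus>\<^bsub>R\<^esub> \<one>\<^bsub>R\<^esub>) \<odot>\<^bsub>?E\<^esub> T \<in> carrier ?E"
        using T by (intro closed) auto
      show "(\<ominus>\<^bsub>R\<^esub> \<one>\<^bsub>R\<^esub>) \<odot>\<^bsub>?E\<^esub> T \<oplus>\<^bsub>?E\<^esub> T = \<zero>\<^bsub>?E\<^esub>"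
        by (rule eqI)
          (use T U in \<open>auto simp: closed apps mem smult_l_minus M.l_neg\<close>)
    qed
  qed (auto intro!: eqI simp: closed apps mem M.a_ac)
  have ring: "ring ?E"
    by (intro ringI abel monoidI)
      (auto intro!: eqI simp: closed apps mem add)
  have "module R ?E"
    by (rule moduleI)
      (auto intro!: eqI abel R.is_cring
        simp: closed apps mem smult_l_distr smult_r_distr smult_assoc1)
  then show ?thesis
    using ring
    by (intro assoc_algebra.intro assoc_algebra_axioms.intro)
      (auto intro!: eqI simp: closed apps mem smult)
qed

section \<open>The free algebra over the field with two elements\<close>

lemma Z2_cring: "cring Z2"
  by (intro cringI abelian_groupI comm_monoidI)
     (auto simp: Z2_def algebra_simps intro: exI[of _ "- x" for x])

lemma bit_poly_mapping_add_self [simp]: "p + p = (0 :: 'k \<Rightarrow>\<^sub>0 bit)"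
  by (rule poly_mapping_eqI) (simp add: lookup_add)

text \<open>
  Over $\mathbb{Z}_2$ a finitely supported map is the sum of the basis vectors in its support, so
  no scalars appear in the induction step.
\<close>

lemma bit_poly_mapping_induct [case_names zero add]:
  assumes "P 0" and "\<And>w p. P p \<Longrightarrow> P (Poly_Mapping.single w 1 + p)"
  shows "P (p :: 'k \<Rightarrow>\<^sub>0 bit)"
proof -
  have "P (\<Sum>w\<in>K. Poly_Mapping.single w 1)" if "finite K" for K
    using that by induction (simp_all add: assms)
  moreover have "(\<Sum>w\<in>Poly_Mapping.keys p. Poly_Mapping.single w 1) = p"
    by (rule poly_mapping_eqI)
      (auto simp: lookup_sum lookup_single when_def sum.delta in_keys_iff)
  ultimately show ?thesis by (metis finite_keys)
qed

lemma free_algebra_simps [simp]: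
  "carrier free_algebra = UNIV" "\<one>\<^bsub>free_algebra\<^esub> = 1" "\<zero>\<^bsub>free_algebra\<^esub> = 0"
  "p \<otimes>\<^bsub>free_algebra\<^esub> q = p * q" "p \<oplus>\<^bsub>free_algebra\<^esub> q = p + q"
  "c \<odot>\<^bsub>free_algebra\<^esub> p = Poly_Mapping.single 0 c * p"
proof -
  show "c \<odot>\<^bsub>free_algebra\<^esub> p = Poly_Mapping.single 0 c * p"
    by (simp only: free_algebra_def module.simps mult_map_scale_conv_mult)
qed (simp_all add: free_algebra_def)

lemma Z2_simps [simp]:
  "carrier Z2 = UNIV" "\<one>\<^bsub>Z2\<^esub> = 1" "\<zero>\<^bsub>Z2\<^esub> = 0" "a \<otimes>\<^bsub>Z2\<^esub> b = a * b" "a \<oplus>\<^bsub>Z2\<^esub> b = a + b"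
  by (simp_all add: Z2_def)

lemma free_assoc_algebra: "assoc_algebra Z2 (free_algebra :: (bit, 'g word \<Rightarrow>\<^sub>0 bit) module)"
proof -
  have ring: "ring (free_algebra :: (bit, 'g word \<Rightarrow>\<^sub>0 bit) module)"
  proof (intro ringI abelian_groupI monoidI)
    show "\<exists>q\<in>carrier free_algebra. q \<oplus>\<^bsub>free_algebra\<^esub> p = \<zero>\<^bsub>free_algebra\<^esub>"
      for p :: "'g word \<Rightarrow>\<^sub>0 bit"
      by (rule bexI[of _ p]) simp_all
  qed (simp_all add: algebra_simps)
  have central: "p * (Poly_Mapping.single 0 c * q) = Poly_Mapping.single 0 c * (p * q)"
    for p q :: "'g word \<Rightarrow>\<^sub>0 bit" and c
    by (cases c) simp_all
  have scalar_add: "Poly_Mapping.single 0 (c + d) * p = Poly_Mapping.single 0 c * p + Poly_Mapping.single 0 d * p"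
    for p :: "'g word \<Rightarrow>\<^sub>0 bit" and c d
    by (simp only: single_add distrib_right)
  have scalar_mult: "Poly_Mapping.single 0 (c * d) * p = Poly_Mapping.single 0 c * (Poly_Mapping.single 0 d * p)"
    for p :: "'g word \<Rightarrow>\<^sub>0 bit" and c d
    by (cases c) simp_all
  have "module Z2 (free_algebra :: (bit, 'g word \<Rightarrow>\<^sub>0 bit) module)"
    by (rule moduleI)
      (simp_all only: free_algebra_simps Z2_simps scalar_add scalar_mult Z2_cring ring
        ring.is_abelian_group distrib_left UNIV_I single_one mult_1_left)
  with ring show ?thesis
    by (intro assoc_algebra.intro assoc_algebra_axioms.intro) (simp_all add: mult.assoc central)
qed

lemma single_Word_eq_prod_list: "Poly_Mapping.single (Word gs) 1 = prod_list (map gen gs)"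
proof (induction gs)
  case Nil
  show ?case by (simp flip: zero_word_def)
next
  case (Cons g gs)
  have "Poly_Mapping.single (Word (g # gs)) 1 = gen g * Poly_Mapping.single (Word gs) (1 :: bit)"
    by (simp add: gen_def mult_single plus_word_def)
  with Cons show ?case by simp
qed

text \<open>
  The step for generators multiplies on the left: words are built up letter by letter from the
  front, which matches the order in which normal forms are computed below.
\<close>

lemma free_algebra_induct [case_names zero one gen add]:
  assumes zero: "P 0" and one: "P 1"
    and gen: "\<And>g p. P p \<Longrightarrow> P (gen g * p)"
    and add: "\<And>p q. P p \<Longrightarrow> P q \<Longrightarrow> P (p + q)"
  shows "P (p :: 'g word \<Rightarrow>\<^sub>0 bit)"
proof (induction p rule: bit_poly_mapping_induct)
  case (add w p)
  have "P (prod_list (map gen gs))" for gs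
    by (induction gs) (simp_all add: one gen)
  then have "P (Poly_Mapping.single w 1)"
    by (cases w) (simp add: single_Word_eq_prod_list)
  then show ?case by (rule assms(4)[OF _ add])
qed (rule zero)


definition word_value :: "('r, 'b, 'm) module_scheme \<Rightarrow> ('g \<Rightarrow> 'b) \<Rightarrow> 'g word \<Rightarrow> 'b" where
  "word_value B \<alpha> w = foldr (\<lambda>g b. \<alpha> g \<otimes>\<^bsub>B\<^esub> b) (letters w) \<one>\<^bsub>B\<^esub>"

definition free_lift :: "(bit, 'b, 'm) module_scheme \<Rightarrow> ('g \<Rightarrow> 'b) \<Rightarrow> ('g word \<Rightarrow>\<^sub>0 bit) \<Rightarrow> 'b" where
  "free_lift B \<alpha> p =
    (\<Oplus>\<^bsub>B\<^esub>w\<in>Poly_Mapping.keys p. Poly_Mapping.lookup p w \<odot>\<^bsub>B\<^esub> word_value B \<alpha> w)"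

lemma algebra_hom_eq_if_eq_on_gens:
  assumes \<phi>: "assoc_algebra_hom Z2 free_algebra B \<phi>"
    and \<psi>: "assoc_algebra_hom Z2 free_algebra B \<psi>"
    and gens: "\<And>g. \<phi> (gen g) = \<psi> (gen g)"
  shows "\<phi> = \<psi>"
proof
  interpret \<phi>: ring_hom_ring free_algebra B \<phi> by (rule assoc_algebra_hom.ring_hom_ring[OF \<phi>])
  interpret \<psi>: ring_hom_ring free_algebra B \<psi> by (rule assoc_algebra_hom.ring_hom_ring[OF \<psi>])
  show "\<phi> p = \<psi> p" for p
  proof (induction p rule: free_algebra_induct)
    case zero
    show ?case using \<phi>.hom_zero \<psi>.hom_zero by simp
  next
    case one
    show ?case using \<phi>.hom_one \<psi>.hom_one by simp
  next
    case (gen g p)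
    then show ?case using \<phi>.hom_mult[of "gen g" p] \<psi>.hom_mult[of "gen g" p] gens by simp
  next
    case (add p q)
    then show ?case using \<phi>.hom_add[of p q] \<psi>.hom_add[of p q] by simp
  qed
qed

text \<open>
  Words multiply by concatenation, and so do their values; by linearity the extension to all
  elements is multiplicative in one factor at a time. Summing over any finite superset of the
  support makes it additive.
\<close>

lemma free_lift_hom:
  assumes "assoc_algebra Z2 B" and \<alpha>: "\<And>g. \<alpha> g \<in> carrier B"
  shows "assoc_algebra_hom Z2 free_algebra B (free_lift B \<alpha>)"
    and "free_lift B \<alpha> (gen g) = \<alpha> g"
proof -
  interpret B: assoc_algebra Z2 B by fact
  let ?v = "word_value B \<alpha>" and ?l = "free_lift B \<alpha>"
  have v: "?v w \<in> carrier B" for w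
  proof -
    have "foldr (\<lambda>g b. \<alpha> g \<otimes>\<^bsub>B\<^esub> b) gs \<one>\<^bsub>B\<^esub> \<in> carrier B" for gs
      by (induction gs) (simp_all add: \<alpha>)
    then show ?thesis by (simp add: word_value_def)
  qed
  have v_add: "?v (u + w) = ?v u \<otimes>\<^bsub>B\<^esub> ?v w" for u w
  proof -
    have "foldr (\<lambda>g b. \<alpha> g \<otimes>\<^bsub>B\<^esub> b) gs (?v w) = foldr (\<lambda>g b. \<alpha> g \<otimes>\<^bsub>B\<^esub> b) gs \<one>\<^bsub>B\<^esub> \<otimes>\<^bsub>B\<^esub> ?v w" for gs
    proof (induction gs)
      case (Cons g gs)
      have "foldr (\<lambda>g b. \<alpha> g \<otimes>\<^bsub>B\<^esub> b) gs \<one>\<^bsub>B\<^esub> \<in> carrier B"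
        by (induction gs) (simp_all add: \<alpha>)
      then show ?case using Cons by (simp add: \<alpha> v B.m_assoc)
    qed (simp add: v)
    then show ?thesis by (simp add: word_value_def plus_word_def)
  qed
  have l_K: "?l p = (\<Oplus>\<^bsub>B\<^esub>w\<in>K. Poly_Mapping.lookup p w \<odot>\<^bsub>B\<^esub> ?v w)"
    if "finite K" "Poly_Mapping.keys p \<subseteq> K" for p K
    unfolding free_lift_def
    by (rule B.add.finprod_mono_neutral_cong_left)
      (use that v B.smult_l_null in \<open>auto simp: in_keys_iff\<close>)
  have l: "?l p \<in> carrier B" for p
    unfolding free_lift_def by (rule B.finsum_closed) (simp add: v)
  have l_add: "?l (p + q) = ?l p \<oplus>\<^bsub>B\<^esub> ?l q" for p q
  proof -
    let ?K = "Poly_Mapping.keys p \<union> Poly_Mapping.keys q"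
    have "?l (p + q) = (\<Oplus>\<^bsub>B\<^esub>w\<in>?K. Poly_Mapping.lookup p w \<odot>\<^bsub>B\<^esub> ?v w
        \<oplus>\<^bsub>B\<^esub> Poly_Mapping.lookup q w \<odot>\<^bsub>B\<^esub> ?v w)"
      using B.smult_l_distr v by (subst l_K[of ?K]) (simp_all add: keys_add lookup_add)
    also have "\<dots> = ?l p \<oplus>\<^bsub>B\<^esub> ?l q"
      by (subst B.finsum_addf) (simp_all add: v l_K[of ?K])
    finally show ?thesis .
  qed
  have l_zero: "?l 0 = \<zero>\<^bsub>B\<^esub>"
    by (simp add: free_lift_def)
  have l_single: "?l (Poly_Mapping.single w 1) = ?v w" for w
    using B.smult_one v by (simp add: free_lift_def)
  have l_word: "?l (Poly_Mapping.single w 1 * q) = ?v w \<otimes>\<^bsub>B\<^esub> ?l q" for w q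
  proof (induction q rule: bit_poly_mapping_induct)
    case (add u q)
    then show ?case
      by (simp add: distrib_left mult_single l_add l_single v v_add l B.r_distr)
  qed (simp add: l_zero v)
  have l_mult: "?l (p * q) = ?l p \<otimes>\<^bsub>B\<^esub> ?l q" for p q
    by (induction p rule: bit_poly_mapping_induct)
      (simp_all add: l_zero l distrib_right l_add l_word l_single v B.l_distr)
  have l_one: "?l 1 = \<one>\<^bsub>B\<^esub>"
    using l_single[of 0] by (simp add: word_value_def) (simp add: zero_word_def)
  show "?l (gen g) = \<alpha> g"
    by (simp add: gen_def l_single word_value_def \<alpha>)
  have "?l (Poly_Mapping.single 0 c * p) = c \<odot>\<^bsub>B\<^esub> ?l p" for c p
    using B.smult_one B.smult_l_null l by (cases c) (simp_all add: l_zero)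
  then show "assoc_algebra_hom Z2 free_algebra B ?l"
    by (intro assoc_algebra_hom.intro assoc_algebra_hom_axioms.intro free_assoc_algebra assms(1)
        ring_hom_memI) (simp_all add: l l_mult l_add l_one)
qed

theorem free_algebra_universal:
  assumes "assoc_algebra Z2 B" and "\<And>g. \<alpha> g \<in> carrier B"
  shows "\<exists>!\<phi>. assoc_algebra_hom Z2 free_algebra B \<phi> \<and> (\<forall>g. \<phi> (gen g) = \<alpha> g)"
proof (rule ex1I)
  show "assoc_algebra_hom Z2 free_algebra B (free_lift B \<alpha>) \<and> (\<forall>g. free_lift B \<alpha> (gen g) = \<alpha> g)"
    using free_lift_hom[of B \<alpha>] assms by blast
  then show "\<phi> = free_lift B \<alpha>"
    if "assoc_algebra_hom Z2 free_algebra B \<phi> \<and> (\<forall>g. \<phi> (gen g) = \<alpha> g)" for \<phi>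
    using that by (intro algebra_hom_eq_if_eq_on_gens) auto
qed

section \<open>Functions on affine space and the Reed-Muller transform\<close>

instance bit :: finite
  by standard (rule finite_subset[of _ "{0, 1}"], auto)

lemma bit_add_self: "b + b = (0 :: bit)"
  by (cases b) simp_all

lemma bit_vec_add_self [simp]: "x + x = (0 :: bit ^ 'n)"
  by (simp add: vec_eq_iff)

lemma bit_vec_add_cancel [simp]: "x + (x + y) = (y :: bit ^ 'n)"
  by (simp flip: add.assoc)

definition monomial_function :: "bit ^ 'n::finite \<Rightarrow> bit ^ 'n \<Rightarrow> bit" where
  "monomial_function a x = (\<Prod>i\<in>UNIV. if a $ i = 1 then x $ i else 1)"

definition reed_muller :: "(bit ^ 'n::finite \<Rightarrow> bit) \<Rightarrow> bit ^ 'n \<Rightarrow> bit" where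
  "reed_muller c x = (\<Sum>a\<in>UNIV. c a * monomial_function a x)"

text \<open>
  The matrix of the Reed-Muller transform is the incidence matrix of inclusion of supports.
\<close>

lemma monomial_function_eq:
  "monomial_function a x = (if {i. a $ i = 1} \<subseteq> {i. x $ i = 1} then 1 else 0)"
proof (cases "{i. a $ i = 1} \<subseteq> {i. x $ i = 1}")
  case True
  then show ?thesis by (auto simp: monomial_function_def intro!: prod.neutral)
next
  case False
  then obtain i where "a $ i = 1" "x $ i \<noteq> 1" by blast
  then have "monomial_function a x = 0"
    unfolding monomial_function_def by (intro prod_zero) (auto intro!: bexI[of _ i])
  with False show ?thesis by simp
qed

lemma bit_vec_eq_iff_support: "a = b \<longleftrightarrow> {i. a $ i = 1} = {i. b $ i = 1}" for a b :: "bit ^ 'n"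
proof -
  have "a $ i = b $ i \<longleftrightarrow> (a $ i = 1 \<longleftrightarrow> b $ i = 1)" for i
    by (cases "a $ i"; cases "b $ i") simp_all
  then show ?thesis by (auto simp: vec_eq_iff)
qed

text \<open>
  The matrix is unitriangular for inclusion of supports, so the coefficients can be recovered from the
  values by induction on the size of the support.
\<close>

lemma inj_reed_muller: "inj reed_muller"
proof (rule injI, rule ext)
  fix c d :: "bit ^ 'n \<Rightarrow> bit" and a
  assume eq: "reed_muller c = reed_muller d"
  show "c a = d a"
  proof (induction "card {i. a $ i = 1}" arbitrary: a rule: less_induct)
    case less
    have expand: "reed_muller e a =
        e a + (\<Sum>b\<in>UNIV - {a}. e b * monomial_function b a)" for e
      unfolding reed_muller_def by (subst sum.remove[of UNIV a]) (simp_all add: monomial_function_eq)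
    have "(\<Sum>b\<in>UNIV - {a}. c b * monomial_function b a) =
        (\<Sum>b\<in>UNIV - {a}. d b * monomial_function b a)"
    proof (rule sum.cong[OF refl])
      fix b assume b: "b \<in> UNIV - {a}"
      show "c b * monomial_function b a = d b * monomial_function b a"
      proof (cases "{i. b $ i = 1} \<subseteq> {i. a $ i = 1}")
        case True
        with b have "{i. b $ i = 1} \<subset> {i. a $ i = 1}" by (auto simp: bit_vec_eq_iff_support)
        then show ?thesis using less by (simp add: psubset_card_mono)
      qed (simp add: monomial_function_eq)
    qed
    with eq show ?case
      using expand[of c] expand[of d] by (metis add_right_cancel)
  qed
qed

lemma surj_reed_muller: "surj (reed_muller :: (bit ^ 'n::finite \<Rightarrow> bit) \<Rightarrow> _)"
  by (rule finite_UNIV_inj_surj[OF finite inj_reed_muller])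

lemma reed_muller_zero_iff: "(\<forall>x. reed_muller c x = 0) \<longleftrightarrow> c = (\<lambda>a. 0)"
proof
  assume "\<forall>x. reed_muller c x = 0"
  then have "reed_muller c = reed_muller (\<lambda>a. 0)" by (auto simp: reed_muller_def)
  then show "c = (\<lambda>a. 0)" by (rule injD[OF inj_reed_muller])
qed (simp add: reed_muller_def)

lemma eval_poly_add: "eval_poly (p + q) x = eval_poly p x + eval_poly q x"
proof -
  let ?K = "Poly_Mapping.keys p \<union> Poly_Mapping.keys q"
  have "eval_poly r x = (\<Sum>m\<in>?K. Poly_Mapping.lookup r m * (\<Prod>i\<in>UNIV. x $ i ^ Poly_Mapping.lookup m i))"
    if "Poly_Mapping.keys r \<subseteq> ?K" for r
    unfolding eval_poly_def
    by (rule sum.mono_neutral_left) (use that in \<open>auto simp: in_keys_iff\<close>)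
  then show ?thesis
    by (simp only: keys_add Un_upper1 Un_upper2 lookup_add distrib_right sum.distrib)
qed

text \<open>
  Every function has an expansion into monomials by \<open>surj_reed_muller\<close>, and the zero-one
  exponent vectors make each of these monomials a genuine polynomial.
\<close>

lemma eval_poly_surj: "range (eval_poly :: _ \<Rightarrow> bit ^ 'n::finite \<Rightarrow> bit) = UNIV"
proof -
  have zero: "(\<lambda>x. 0) \<in> range (eval_poly :: _ \<Rightarrow> bit ^ 'n \<Rightarrow> bit)"
    by (rule range_eqI[of _ _ 0]) (auto simp: eval_poly_def)
  have monom: "monomial_function a \<in> range eval_poly" for a :: "bit ^ 'n"
  proof -
    have "Poly_Mapping.lookup (Abs_poly_mapping (\<lambda>i. if a $ i = 1 then 1 else 0 :: nat)) i
        = (if a $ i = 1 then 1 else 0)" for i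
      by (subst lookup_Abs_poly_mapping) simp_all
    then have "(\<Prod>i\<in>UNIV. x $ i ^ Poly_Mapping.lookup (Abs_poly_mapping (\<lambda>i. if a $ i = 1 then 1 else 0)) i)
        = monomial_function a x" for x
      unfolding monomial_function_def by (intro prod.cong refl) auto
    then have "eval_poly (Poly_Mapping.single
          (Abs_poly_mapping (\<lambda>i. if a $ i = 1 then 1 else 0)) 1) = monomial_function a"
      by (simp add: eval_poly_def fun_eq_iff del: lookup_Abs_poly_mapping)
    then show ?thesis by (metis rangeI)
  qed
  have "(\<lambda>x. \<Sum>a\<in>K. c a * monomial_function a x) \<in> range eval_poly"
    for c and K :: "(bit ^ 'n) set"
  proof (induction K rule: infinite_finite_induct)
    case (insert a K)
    from insert.IH obtain p where p: "(\<lambda>x. \<Sum>a\<in>K. c a * monomial_function a x) = eval_poly p"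
      by auto
    obtain q where q: "monomial_function a = eval_poly q" using monom[of a] by auto
    show ?case
    proof (cases "c a = 0")
      case True
      with insert show ?thesis by simp
    next
      case False
      then have "c a = 1" by simp
      then have "(\<lambda>x. \<Sum>a\<in>insert a K. c a * monomial_function a x) = eval_poly (q + p)"
        by (simp only: sum.insert[OF insert.hyps] fun_cong[OF p] q mult_1_left eval_poly_add fun_eq_iff)
          simp
      then show ?thesis by (metis rangeI)
    qed
  qed (simp_all add: zero)
  then have "reed_muller c \<in> range eval_poly" for c :: "bit ^ 'n \<Rightarrow> bit"
    using reed_muller_def[of c] by (metis (no_types, lifting) ext)
  then show ?thesis using surj_reed_muller by (metis UNIV_eq_I surjD)
qed

lemma regular_functions_simps [simp]:
  "carrier regular_functions = UNIV"
  "f \<oplus>\<^bsub>regular_functions\<^esub> g = (\<lambda>x. f x + g x)"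
  "f \<otimes>\<^bsub>regular_functions\<^esub> g = (\<lambda>x. f x * g x)"
  "\<zero>\<^bsub>regular_functions\<^esub> = (\<lambda>x. 0)"
  "c \<odot>\<^bsub>regular_functions\<^esub> f = (\<lambda>x. c * f x)"
  by (simp_all only: regular_functions_def eval_poly_surj partial_object.simps ring.simps
      module.simps monoid.simps)

lemma regular_functions_module:
  "module Z2 (regular_functions :: (bit, bit ^ 'n::finite \<Rightarrow> bit) module)"
proof (intro moduleI abelian_groupI)
  show "\<exists>g\<in>carrier regular_functions. g \<oplus>\<^bsub>regular_functions\<^esub> f = \<zero>\<^bsub>regular_functions\<^esub>"
    for f :: "bit ^ 'n \<Rightarrow> bit"
    by (rule bexI[of _ f]) simp_all
qed (simp_all only: Z2_cring regular_functions_simps Z2_simps UNIV_I distrib_left distrib_right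
    mult_1_left mult.assoc add.assoc add.commute add.left_commute add_0_left)

lemma endo_regular_functions_simps [simp]:
  "\<one>\<^bsub>endo_algebra Z2 regular_functions\<^esub> f = f"
  "\<zero>\<^bsub>endo_algebra Z2 regular_functions\<^esub> f x = 0"
  "(T \<oplus>\<^bsub>endo_algebra Z2 regular_functions\<^esub> U) f x = T f x + U f x"
  "(T \<otimes>\<^bsub>endo_algebra Z2 regular_functions\<^esub> U) f = T (U f)"
  "(c \<odot>\<^bsub>endo_algebra Z2 regular_functions\<^esub> T) f x = c * T f x"
  by (simp_all add: endo_algebra_def compose_def)

lemma endo_regular_functions_carrier:
  "T \<in> carrier (endo_algebra Z2 regular_functions) \<longleftrightarrow>
    (\<forall>f g. T (\<lambda>x. f x + g x) = (\<lambda>x. T f x + T g x)) \<and> (\<forall>c f. T (\<lambda>x. c * f x) = (\<lambda>x. c * T f x))"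
  by (simp only: endo_algebra_def regular_functions_simps partial_object.simps Z2_simps PiE_UNIV_domain mem_Collect_eq UNIV_I Pi_UNIV ball_UNIV)
    simp

definition delta :: "'a \<Rightarrow> 'a \<Rightarrow> bit" where
  "delta y x = (if x = y then 1 else 0)"

text \<open>
  An operator is determined by its values on the indicator functions, which form a basis.
\<close>

lemma endo_regular_functions_expand:
  assumes T: "T \<in> carrier (endo_algebra Z2 (regular_functions :: (bit, bit ^ 'n::finite \<Rightarrow> bit) module))"
  shows "T f x = (\<Sum>y\<in>UNIV. f y * T (delta y) x)"
proof -
  have add: "T (\<lambda>x. f x + g x) = (\<lambda>x. T f x + T g x)"
    and smult: "T (\<lambda>x. c * f x) = (\<lambda>x. c * T f x)" for f g c
    using T by (simp_all only: endo_regular_functions_carrier)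
  have "T (\<lambda>x. \<Sum>y\<in>K. f y * delta y x) = (\<lambda>x. \<Sum>y\<in>K. f y * T (delta y) x)"
    for K :: "(bit ^ 'n) set"
  proof (induction K rule: infinite_finite_induct)
    case (insert y K)
    have "T (\<lambda>x. \<Sum>y\<in>insert y K. f y * delta y x) =
        T (\<lambda>x. f y * delta y x + (\<Sum>y\<in>K. f y * delta y x))"
      using insert.hyps by (simp only: sum.insert not_False_eq_True)
    also have "\<dots> = (\<lambda>x. \<Sum>y\<in>insert y K. f y * T (delta y) x)"
      using insert by (simp only: add smult sum.insert not_False_eq_True)
    finally show ?case .
  qed (use smult[of 0] in simp_all)
  moreover have "(\<Sum>y\<in>UNIV. f y * delta y x) = f x" for x
  proof -
    have "f y * delta y x = (if x = y then f y else 0)" for y by (simp add: delta_def)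
    then show ?thesis by simp
  qed
  ultimately show ?thesis by (metis (no_types, lifting) ext)
qed

section \<open>Normal forms in the shifted Boole-Weyl algebra\<close>

abbreviation X :: "'n::finite \<Rightarrow> 'n sbw_gen word \<Rightarrow>\<^sub>0 bit" where "X i \<equiv> gen (Xgen i)"
abbreviation S :: "'n::finite \<Rightarrow> 'n sbw_gen word \<Rightarrow>\<^sub>0 bit" where "S i \<equiv> gen (Sgen i)"

text \<open>
  Congruence modulo the ideal. In characteristic two the difference of two elements is their sum.
\<close>

definition sbw_eq :: "('n::finite sbw_gen word \<Rightarrow>\<^sub>0 bit) \<Rightarrow> ('n sbw_gen word \<Rightarrow>\<^sub>0 bit) \<Rightarrow> bool"
    (infix \<open>\<simeq>\<^sub>S\<close> 50) where
  "p \<simeq>\<^sub>S q \<longleftrightarrow> p + q \<in> sbw_ideal"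

lemma sbw_ideal: "ideal sbw_ideal free_algebra"
proof -
  interpret assoc_algebra Z2 "free_algebra :: (bit, 'a sbw_gen word \<Rightarrow>\<^sub>0 bit) module"
    by (rule free_assoc_algebra)
  show ?thesis unfolding sbw_ideal_def by (rule genideal_ideal) simp
qed

lemma sbw_relation_mem: "r \<in> sbw_relations \<Longrightarrow> r \<in> sbw_ideal"
proof -
  interpret assoc_algebra Z2 "free_algebra :: (bit, 'a sbw_gen word \<Rightarrow>\<^sub>0 bit) module"
    by (rule free_assoc_algebra)
  show "r \<in> sbw_relations \<Longrightarrow> r \<in> sbw_ideal"
    using genideal_self[of sbw_relations] by (auto simp: sbw_ideal_def)
qed

lemma sbw_ideal_closed:
  fixes p q r :: "'n::finite sbw_gen word \<Rightarrow>\<^sub>0 bit"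
  shows "(0 :: 'n sbw_gen word \<Rightarrow>\<^sub>0 bit) \<in> sbw_ideal"
  and "p \<in> sbw_ideal \<Longrightarrow> q \<in> sbw_ideal \<Longrightarrow> p + q \<in> sbw_ideal"
  and "p \<in> sbw_ideal \<Longrightarrow> r * p \<in> sbw_ideal"
  and "p \<in> sbw_ideal \<Longrightarrow> p * r \<in> sbw_ideal"
proof -
  interpret ideal sbw_ideal "free_algebra :: (bit, 'n sbw_gen word \<Rightarrow>\<^sub>0 bit) module"
    by (rule sbw_ideal)
  show "(0 :: 'n sbw_gen word \<Rightarrow>\<^sub>0 bit) \<in> sbw_ideal" using additive_subgroup.zero_closed[OF is_additive_subgroup] by simp
  show "p \<in> sbw_ideal \<Longrightarrow> q \<in> sbw_ideal \<Longrightarrow> p + q \<in> sbw_ideal"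
    using additive_subgroup.a_closed[OF is_additive_subgroup, of p q] by simp
  show "p \<in> sbw_ideal \<Longrightarrow> r * p \<in> sbw_ideal" using I_l_closed[of p r] by simp
  show "p \<in> sbw_ideal \<Longrightarrow> p * r \<in> sbw_ideal" using I_r_closed[of p r] by simp
qed

lemma sbw_eq_refl [simp, intro]: "p \<simeq>\<^sub>S p"
  by (simp add: sbw_eq_def sbw_ideal_closed)

lemma sbw_eq_trans [trans]: "p \<simeq>\<^sub>S q \<Longrightarrow> q \<simeq>\<^sub>S r \<Longrightarrow> p \<simeq>\<^sub>S r"
proof -
  assume "p \<simeq>\<^sub>S q" "q \<simeq>\<^sub>S r"
  then have "(p + q) + (q + r) \<in> sbw_ideal"
    unfolding sbw_eq_def by (rule sbw_ideal_closed)
  also have "(p + q) + (q + r) = p + (q + q) + r" by (simp only: add.assoc)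
  finally show ?thesis by (simp add: sbw_eq_def)
qed

lemma sbw_eq_add: "p \<simeq>\<^sub>S q \<Longrightarrow> r \<simeq>\<^sub>S s \<Longrightarrow> p + r \<simeq>\<^sub>S q + s"
  unfolding sbw_eq_def using sbw_ideal_closed(2)[of "p + q" "r + s"] by (simp add: ac_simps)

lemma sbw_eq_mult: "p \<simeq>\<^sub>S q \<Longrightarrow> r \<simeq>\<^sub>S s \<Longrightarrow> p * r \<simeq>\<^sub>S q * s"
proof -
  assume *: "p \<simeq>\<^sub>S q" "r \<simeq>\<^sub>S s"
  have "p * r \<simeq>\<^sub>S q * r"
    using * sbw_ideal_closed(4)[of "p + q" r] by (simp add: sbw_eq_def distrib_right)
  also have "\<dots> \<simeq>\<^sub>S q * s"
    using * sbw_ideal_closed(3)[of "r + s" q] by (simp add: sbw_eq_def distrib_left)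
  finally show ?thesis .
qed

lemma sbw_eq_commute_mult:
  assumes "p * q \<simeq>\<^sub>S q * p" "p * r \<simeq>\<^sub>S r * p"
  shows "p * (q * r) \<simeq>\<^sub>S (q * r) * p"
proof -
  have "p * (q * r) = (p * q) * r" by (simp add: mult.assoc)
  also have "\<dots> \<simeq>\<^sub>S (q * p) * r" by (intro sbw_eq_mult assms sbw_eq_refl)
  also have "\<dots> = q * (p * r)" by (simp add: mult.assoc)
  also have "\<dots> \<simeq>\<^sub>S q * (r * p)" by (intro sbw_eq_mult assms sbw_eq_refl)
  also have "\<dots> = (q * r) * p" by (simp add: mult.assoc)
  finally show ?thesis .
qed

lemma sbw_eq_relations:
  shows X_idem: "X i * X i \<simeq>\<^sub>S X i"
    and S_involution: "S i * S i \<simeq>\<^sub>S 1"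
    and S_X: "S i * X i \<simeq>\<^sub>S X i * S i + S i"
    and X_X_commute: "X i * X j \<simeq>\<^sub>S X j * X i"
    and S_S_commute: "S i * S j \<simeq>\<^sub>S S j * S i"
    and S_X_commute: "i \<noteq> j \<Longrightarrow> S i * X j \<simeq>\<^sub>S X j * S i"
  unfolding sbw_eq_def
  by (rule sbw_relation_mem, force simp: sbw_relations_def power2_eq_square add.assoc)+

text \<open>
  The free algebra is not commutative, so a monomial with exponent vector in $\{0, 1\}^n$ needs an
  order of its factors. The list of indices is a parameter to allow inductive proofs.
\<close>

definition ordered_prod :: "('n \<Rightarrow> 'a::monoid_mult) \<Rightarrow> bit ^ 'n::finite \<Rightarrow> 'n list \<Rightarrow> 'a" where
  "ordered_prod G a is = prod_list (map (\<lambda>i. if a $ i = 1 then G i else 1) is)"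

definition index_list :: "'n::finite list" where
  "index_list = (SOME is. set is = UNIV \<and> distinct is)"

lemma index_list: "set (index_list :: 'n::finite list) = UNIV" "distinct (index_list :: 'n list)"
proof -
  obtain js :: "'n list" where "set js = UNIV \<and> distinct js"
    using finite_distinct_list[of "UNIV :: 'n set"] by auto
  then have "set (index_list :: 'n list) = UNIV \<and> distinct (index_list :: 'n list)"
    unfolding index_list_def by (rule someI)
  then show "set (index_list :: 'n list) = UNIV" "distinct (index_list :: 'n list)" by auto
qed

lemma ordered_prod_commute:
  assumes "\<And>j. j \<in> set js \<Longrightarrow> p * G j \<simeq>\<^sub>S G j * p"
  shows "p * ordered_prod G a js \<simeq>\<^sub>S ordered_prod G a js * p"
  using assms
proof (induction js)
  case (Cons j js)
  have "p * ordered_prod G a js \<simeq>\<^sub>S ordered_prod G a js * p" by (rule Cons.IH) (simp add: Cons.prems)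
  with Cons.prems[of j] show ?case
    by (auto simp: ordered_prod_def intro!: sbw_eq_commute_mult)
qed (simp add: ordered_prod_def)

definition set_entry :: "bit ^ 'n \<Rightarrow> 'n::finite \<Rightarrow> bit \<Rightarrow> bit ^ 'n" where
  "set_entry a i c = (\<chi> j. if j = i then c else a $ j)"

lemma set_entry_self [simp]: "set_entry a i (a $ i) = a"
  by (simp add: set_entry_def vec_eq_iff)

text \<open>
  Isolates the factor with index $i$. The outer factors $U$ and $V$ do not depend on the entry $c$ at
  position $i$, so that changing this entry only changes the middle factor; and they commute with
  everything that commutes with the generators other than the $i$-th one. All the rewriting of
  monomials below happens at the middle factor.
\<close>

lemma ordered_prod_split:
  fixes G :: "'n \<Rightarrow> 'n::finite sbw_gen word \<Rightarrow>\<^sub>0 bit"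
  obtains U V where
    "\<And>c. ordered_prod G (set_entry a i c) index_list = U * (if c = 1 then G i else 1) * V"
    "\<And>p. (\<And>j. j \<noteq> i \<Longrightarrow> p * G j \<simeq>\<^sub>S G j * p) \<Longrightarrow> p * U \<simeq>\<^sub>S U * p"
    "\<And>p. (\<And>j. j \<noteq> i \<Longrightarrow> p * G j \<simeq>\<^sub>S G j * p) \<Longrightarrow> p * V \<simeq>\<^sub>S V * p"
proof -
  obtain us vs where split: "index_list = us @ i # vs"
    using index_list(1) by (metis UNIV_I split_list)
  then have "distinct (us @ i # vs)" using index_list(2) by metis
  then have i: "i \<notin> set us" "i \<notin> set vs" by simp_all
  let ?U = "ordered_prod G a us" and ?V = "ordered_prod G a vs"
  have eq: "ordered_prod G (set_entry a i c) js = ordered_prod G a js" if "i \<notin> set js" for c js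
    using that by (auto simp: ordered_prod_def set_entry_def intro!: arg_cong[of _ _ prod_list])
  show ?thesis
  proof
    show "ordered_prod G (set_entry a i c) index_list = ?U * (if c = 1 then G i else 1) * ?V" for c
    proof -
      have "ordered_prod G (set_entry a i c) index_list = ordered_prod G (set_entry a i c) us *
          (if c = 1 then G i else 1) * ordered_prod G (set_entry a i c) vs"
        by (simp add: split ordered_prod_def mult.assoc) (simp add: set_entry_def)
      then show ?thesis by (simp add: eq i)
    qed
    show "p * ?U \<simeq>\<^sub>S ?U * p" if "\<And>j. j \<noteq> i \<Longrightarrow> p * G j \<simeq>\<^sub>S G j * p" for p
      by (rule ordered_prod_commute) (use that i in metis)
    show "p * ?V \<simeq>\<^sub>S ?V * p" if "\<And>j. j \<noteq> i \<Longrightarrow> p * G j \<simeq>\<^sub>S G j * p" for p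
      by (rule ordered_prod_commute) (use that i in metis)
  qed
qed

abbreviation X_monomial :: "bit ^ 'n::finite \<Rightarrow> 'n sbw_gen word \<Rightarrow>\<^sub>0 bit" where
  "X_monomial a \<equiv> ordered_prod X a index_list"

abbreviation S_monomial :: "bit ^ 'n::finite \<Rightarrow> 'n sbw_gen word \<Rightarrow>\<^sub>0 bit" where
  "S_monomial b \<equiv> ordered_prod S b index_list"

text \<open>
  A generator that commutes with the others is moved to its own slot in the monomial, where it
  combines with the factor already present. Used with idempotents and with involutions.
\<close>

lemma ordered_prod_absorb:
  fixes G :: "'n \<Rightarrow> 'n::finite sbw_gen word \<Rightarrow>\<^sub>0 bit"
  assumes commute: "\<And>j. G i * G j \<simeq>\<^sub>S G j * G i"
    and head: "G i * (if a $ i = 1 then G i else 1) \<simeq>\<^sub>S (if c = 1 then G i else 1)"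
  shows "G i * ordered_prod G a index_list \<simeq>\<^sub>S ordered_prod G (set_entry a i c) index_list"
proof -
  obtain U V where UV: "\<And>c. ordered_prod G (set_entry a i c) index_list = U * (if c = 1 then G i else 1) * V"
    and U: "G i * U \<simeq>\<^sub>S U * G i"
    using ordered_prod_split[of G a i] commute by metis
  let ?g = "if a $ i = 1 then G i else 1"
  have "G i * ordered_prod G a index_list = (G i * U) * (?g * V)"
    using UV[of "a $ i"] by (simp add: mult.assoc)
  also have "\<dots> \<simeq>\<^sub>S (U * G i) * (?g * V)" by (intro sbw_eq_mult U sbw_eq_refl)
  also have "\<dots> = U * ((G i * ?g) * V)" by (simp only: mult.assoc)
  also have "\<dots> \<simeq>\<^sub>S U * ((if c = 1 then G i else 1) * V)"
    by (intro sbw_eq_mult head sbw_eq_refl)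
  also have "\<dots> = ordered_prod G (set_entry a i c) index_list" by (simp add: UV mult.assoc)
  finally show ?thesis .
qed

lemma X_X_monomial: "X i * X_monomial a \<simeq>\<^sub>S X_monomial (set_entry a i 1)"
  by (rule ordered_prod_absorb) (auto simp: X_idem X_X_commute)

lemma S_S_monomial: "S i * S_monomial b \<simeq>\<^sub>S S_monomial (set_entry b i (b $ i + 1))"
  by (rule ordered_prod_absorb) (auto simp: S_involution S_S_commute)

lemma S_X_monomial_absent: 
  assumes "a $ i = 0"
  shows "S i * X_monomial a \<simeq>\<^sub>S X_monomial a * S i"
proof -
  obtain U V where UV: "\<And>c. X_monomial (set_entry a i c) = U * (if c = 1 then X i else 1) * V"
    and comm: "S i * U \<simeq>\<^sub>S U * S i" "S i * V \<simeq>\<^sub>S V * S i"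
    using ordered_prod_split[of X a i] S_X_commute[of i] by metis
  from UV[of "a $ i", unfolded set_entry_self] assms have "X_monomial a = U * V" by simp
  with sbw_eq_commute_mult[OF comm] show ?thesis by simp
qed

text \<open>
  Moving the shift past its own coordinate is the only place where a second term arises.
\<close>

lemma S_X_monomial_present:
  assumes "a $ i = 1"
  shows "S i * X_monomial a \<simeq>\<^sub>S X_monomial a * S i + X_monomial (set_entry a i 0) * S i"
proof -
  obtain U V where UV: "\<And>c. X_monomial (set_entry a i c) = U * (if c = 1 then X i else 1) * V"
    and U: "S i * U \<simeq>\<^sub>S U * S i" and V: "S i * V \<simeq>\<^sub>S V * S i"
    using ordered_prod_split[of X a i] S_X_commute[of i] by metis
  from UV[of "a $ i", unfolded set_entry_self] assms have a: "X_monomial a = U * X i * V" by simp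
  then have "S i * X_monomial a = (S i * U) * (X i * V)" by (simp add: mult.assoc)
  also have "\<dots> \<simeq>\<^sub>S (U * S i) * (X i * V)" by (intro sbw_eq_mult U sbw_eq_refl)
  also have "\<dots> = U * (S i * X i) * V" by (simp add: mult.assoc)
  also have "\<dots> \<simeq>\<^sub>S U * (X i * S i + S i) * V" by (intro sbw_eq_mult S_X sbw_eq_refl)
  also have "\<dots> = (U * X i) * (S i * V) + U * (S i * V)"
    by (simp add: algebra_simps)
  also have "\<dots> \<simeq>\<^sub>S (U * X i) * (V * S i) + U * (V * S i)"
    by (intro sbw_eq_add sbw_eq_mult V sbw_eq_refl)
  also have "\<dots> = X_monomial a * S i + X_monomial (set_entry a i 0) * S i"
    by (simp add: a UV mult.assoc)
  finally show ?thesis .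
qed

definition normal_form :: "(bit ^ 'n::finite \<Rightarrow> bit ^ 'n \<Rightarrow> bit) \<Rightarrow> 'n sbw_gen word \<Rightarrow>\<^sub>0 bit" where
  "normal_form F = (\<Sum>(a, b)\<in>UNIV. Poly_Mapping.single 0 (F a b) * (X_monomial a * S_monomial b))"

definition has_normal_form :: "('n::finite sbw_gen word \<Rightarrow>\<^sub>0 bit) \<Rightarrow> bool" where
  "has_normal_form p \<longleftrightarrow> (\<exists>F. p \<simeq>\<^sub>S normal_form F)"

lemma has_normal_form_cong: "p \<simeq>\<^sub>S q \<Longrightarrow> has_normal_form q \<Longrightarrow> has_normal_form p"
  unfolding has_normal_form_def using sbw_eq_trans by blast

lemma has_normal_form_zero: "has_normal_form 0"
  unfolding has_normal_form_def by (rule exI[of _ "\<lambda>a b. 0"]) (simp add: normal_form_def)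

lemma has_normal_form_add:
  assumes "has_normal_form p" "has_normal_form q"
  shows "has_normal_form (p + q)"
proof -
  from assms obtain F G where "p \<simeq>\<^sub>S normal_form F" "q \<simeq>\<^sub>S normal_form G"
    by (auto simp: has_normal_form_def)
  moreover have "normal_form F + normal_form G = normal_form (\<lambda>a b. F a b + G a b)"
    by (simp only: normal_form_def single_add distrib_right sum.distrib case_prod_unfold)
  ultimately show ?thesis
    unfolding has_normal_form_def by (metis sbw_eq_add)
qed

lemma has_normal_form_monomial: "has_normal_form (X_monomial a * S_monomial b)"
proof -
  have "normal_form (\<lambda>a' b'. if (a', b') = (a, b) then 1 else 0) =
      (\<Sum>c\<in>UNIV. if c = (a, b) then X_monomial a * S_monomial b else 0)"
    unfolding normal_form_def
  proof (rule sum.cong[OF refl])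
    show "(case c of (a', b') \<Rightarrow> Poly_Mapping.single 0 (if (a', b') = (a, b) then 1 else 0) *
        (X_monomial a' * S_monomial b')) = (if c = (a, b) then X_monomial a * S_monomial b else 0)" for c
      by (cases "c = (a, b)") (auto simp: case_prod_unfold prod_eq_iff)
  qed
  also have "\<dots> = X_monomial a * S_monomial b" by simp
  finally show ?thesis unfolding has_normal_form_def by (metis sbw_eq_refl)
qed

text \<open>
  By linearity it suffices to multiply monomials.
\<close>

lemma has_normal_form_mult:
  assumes mono: "\<And>a b. has_normal_form (p * (X_monomial a * S_monomial b))"
    and q: "has_normal_form q"
  shows "has_normal_form (p * q)"
proof -
  from q obtain F where F: "q \<simeq>\<^sub>S normal_form F" by (auto simp: has_normal_form_def)
  have "has_normal_form (p * (\<Sum>(a, b)\<in>K. Poly_Mapping.single 0 (F a b) * (X_monomial a * S_monomial b)))"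
    for K
  proof (induction K rule: infinite_finite_induct)
    case (insert c K)
    obtain a b where c: "c = (a, b)" by (cases c)
    have "has_normal_form (p * (Poly_Mapping.single 0 (F a b) * (X_monomial a * S_monomial b)))"
      by (cases "F a b") (simp_all add: mono has_normal_form_zero)
    with insert show ?case by (simp add: c distrib_left has_normal_form_add)
  qed (simp_all add: has_normal_form_zero)
  then have "has_normal_form (p * normal_form F)" by (simp add: normal_form_def)
  then show ?thesis by (rule has_normal_form_cong[rotated]) (intro sbw_eq_mult F sbw_eq_refl)
qed

text \<open>
  The elements with a normal form are closed under addition and under left multiplication by
  generators, and they include the empty monomial.
\<close>

theorem every_has_normal_form:
  fixes p :: "'n::finite sbw_gen word \<Rightarrow>\<^sub>0 bit"
  shows "has_normal_form p"
proof (induction p rule: free_algebra_induct)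
  case zero
  show ?case by (rule has_normal_form_zero)
next
  case one
  have "ordered_prod G 0 js = 1" for G :: "'n \<Rightarrow> 'n sbw_gen word \<Rightarrow>\<^sub>0 bit" and js
    by (induction js) (simp_all add: ordered_prod_def)
  with has_normal_form_monomial[of "0 :: bit ^ 'n" 0] show ?case by simp
next
  case (gen g p)
  have "has_normal_form (gen g * (X_monomial a * S_monomial b))" for a b
  proof (cases g)
    case (Xgen i)
    have "X i * (X_monomial a * S_monomial b) \<simeq>\<^sub>S X_monomial (set_entry a i 1) * S_monomial b"
      unfolding mult.assoc[symmetric] by (intro sbw_eq_mult X_X_monomial sbw_eq_refl)
    then show ?thesis
      unfolding Xgen by (rule has_normal_form_cong) (rule has_normal_form_monomial)
  next
    case (Sgen i)
    have S: "has_normal_form (X_monomial a' * S i * S_monomial b)" for a'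
    proof (rule has_normal_form_cong)
      show "X_monomial a' * S i * S_monomial b
          \<simeq>\<^sub>S X_monomial a' * S_monomial (set_entry b i (b $ i + 1))"
        unfolding mult.assoc by (intro sbw_eq_mult S_S_monomial sbw_eq_refl)
    qed (rule has_normal_form_monomial)
    show ?thesis
    proof (cases "a $ i = 0")
      case True
      have "S i * (X_monomial a * S_monomial b) \<simeq>\<^sub>S X_monomial a * S i * S_monomial b"
        unfolding mult.assoc[of "S i", symmetric]
        by (intro sbw_eq_mult S_X_monomial_absent True sbw_eq_refl)
      then show ?thesis unfolding Sgen by (rule has_normal_form_cong) (rule S)
    next
      case False
      then have "S i * (X_monomial a * S_monomial b)
          \<simeq>\<^sub>S (X_monomial a * S i + X_monomial (set_entry a i 0) * S i) * S_monomial b"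
        unfolding mult.assoc[of "S i", symmetric]
        by (intro sbw_eq_mult S_X_monomial_present sbw_eq_refl) simp
      then show ?thesis
        unfolding Sgen distrib_right
        by (rule has_normal_form_cong) (intro has_normal_form_add S)
    qed
  qed
  then show ?case by (rule has_normal_form_mult) (rule gen)
next
  case (add p q)
  then show ?case by (rule has_normal_form_add)
qed

section \<open>The action on functions\<close>

locale sbw_representation =
  fixes \<phi> :: "('n::finite sbw_gen word \<Rightarrow>\<^sub>0 bit) \<Rightarrow> (bit ^ 'n \<Rightarrow> bit) \<Rightarrow> (bit ^ 'n \<Rightarrow> bit)"
  assumes action: "sbw_action \<phi>"
begin

lemma hom: "assoc_algebra_hom Z2 free_algebra (endo_algebra Z2 regular_functions) \<phi>"
  using action by (simp add: sbw_action_def)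

sublocale ring_hom_ring free_algebra "endo_algebra Z2 regular_functions" \<phi>
  by (rule assoc_algebra_hom.ring_hom_ring[OF hom])

lemma action_zero: "\<phi> 0 f x = 0" and action_one: "\<phi> 1 f = f"
  using hom_zero hom_one by simp_all

lemma action_add: "\<phi> (p + q) f x = \<phi> p f x + \<phi> q f x"
  using hom_add[of p q] by simp

lemma action_mult: "\<phi> (p * q) f = \<phi> p (\<phi> q f)"
  using hom_mult[of p q] by simp

lemma action_scalar: "\<phi> (Poly_Mapping.single 0 c) f x = c * f x"
  by (cases c) (simp_all add: action_zero action_one)

lemma action_X: "\<phi> (X i) f x = x $ i * f x"
  using action by (simp add: sbw_action_def mult_op_def coord_def)

lemma action_S: "\<phi> (S i) f x = f (x + axis i 1)"
  using action by (simp add: sbw_action_def shift_op_def)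

lemma action_sum: "\<phi> (sum p K) f x = (\<Sum>k\<in>K. \<phi> (p k) f x)"
  by (induction K rule: infinite_finite_induct) (simp_all add: action_zero action_add)

lemma action_X_monomial: "\<phi> (X_monomial a) f x = monomial_function a x * f x"
proof -
  have "\<phi> (ordered_prod X a js) f x = prod_list (map (\<lambda>i. if a $ i = 1 then x $ i else 1) js) * f x"
    for js
    by (induction js) (simp_all add: ordered_prod_def action_one action_mult action_X)
  moreover have "prod_list (map (\<lambda>i. if a $ i = 1 then x $ i else 1) index_list) = monomial_function a x"
    unfolding monomial_function_def
    using prod.distinct_set_conv_list[OF index_list(2), of "\<lambda>i. if a $ i = 1 then x $ i else 1"]
    by (simp only: index_list)
  ultimately show ?thesis by simp
qed

lemma action_S_monomial: "\<phi> (S_monomial b) f x = f (x + b)"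
proof -
  have axis_zero: "axis i 0 = (0 :: bit ^ 'n)" for i
    by (simp add: axis_def vec_eq_iff)
  have "\<phi> (ordered_prod S b js) f x = f (x + sum_list (map (\<lambda>i. axis i (b $ i)) js))" for js
  proof (induction js arbitrary: x)
    case (Cons i js)
    then show ?case
      by (cases "b $ i")
        (simp_all add: ordered_prod_def action_one action_mult action_S add.assoc axis_zero)
  qed (simp add: ordered_prod_def action_one)
  moreover have "sum_list (map (\<lambda>i. axis i (b $ i)) index_list) = b"
  proof -
    have "sum_list (map (\<lambda>i. axis i (b $ i)) index_list) = (\<Sum>i\<in>UNIV. axis i (b $ i))"
      using sum.distinct_set_conv_list[OF index_list(2), of "\<lambda>i. axis i (b $ i)"]
      by (simp only: index_list)
    also have "\<dots> = b"
      by (simp add: vec_eq_iff axis_def sum.delta)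
    finally show ?thesis .
  qed
  ultimately show ?thesis by simp
qed

text \<open>
  Normal forms act as convolution-like operators whose kernel is the Reed-Muller transform of the
  coefficients in the first argument.
\<close>

lemma action_normal_form:
  "\<phi> (normal_form F) f x = (\<Sum>b\<in>UNIV. reed_muller (\<lambda>a. F a b) x * f (x + b))"
proof -
  have "\<phi> (normal_form F) f x =
      (\<Sum>(a, b)\<in>UNIV. F a b * (monomial_function a x * f (x + b)))"
    unfolding normal_form_def action_sum
    by (rule sum.cong[OF refl])
      (simp only: case_prod_unfold action_scalar action_mult action_X_monomial action_S_monomial)
  also have "\<dots> = (\<Sum>a\<in>UNIV. \<Sum>b\<in>UNIV. F a b * (monomial_function a x * f (x + b)))"
    by (simp only: sum.cartesian_product UNIV_Times_UNIV)
  also have "\<dots> = (\<Sum>b\<in>UNIV. \<Sum>a\<in>UNIV. F a b * (monomial_function a x * f (x + b)))"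
    by (rule sum.swap)
  also have "\<dots> = (\<Sum>b\<in>UNIV. reed_muller (\<lambda>a. F a b) x * f (x + b))"
    by (simp only: reed_muller_def sum_distrib_right mult.assoc)
  finally show ?thesis .
qed

text \<open>
  Applied to an indicator function the sum over shifts collapses to the single shift from $x$ to
  $y$, so that the kernel can be read off.
\<close>

lemma action_normal_form_delta:
  "\<phi> (normal_form F) (delta y) x = reed_muller (\<lambda>a. F a (x + y)) x"
proof -
  have "\<phi> (normal_form F) (delta y) x =
      (\<Sum>b\<in>UNIV. if b = x + y then reed_muller (\<lambda>a. F a b) x else 0)"
    unfolding action_normal_form
  proof (rule sum.cong[OF refl])
    fix b
    have "x + b = y \<longleftrightarrow> b = x + y" by auto
    then show "reed_muller (\<lambda>a. F a b) x * delta y (x + b) =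
        (if b = x + y then reed_muller (\<lambda>a. F a b) x else 0)"
      by (simp add: delta_def)
  qed
  then show ?thesis by simp
qed

text \<open>
  The kernel vanishes together with the operator, and the Reed-Muller transform is injective. So the
  coefficients vanish, and the normal form is zero in the free algebra itself.
\<close>

lemma normal_form_faithful:
  assumes "\<And>f x. \<phi> (normal_form F) f x = 0"
  shows "normal_form F = 0"
proof -
  have "reed_muller (\<lambda>a. F a b) x = 0" for b x
    using assms[of "delta (x + b)" x] by (simp add: action_normal_form_delta)
  then have "(\<lambda>a. F a b) = (\<lambda>a. 0)" for b
    by (intro iffD1[OF reed_muller_zero_iff] allI)
  then have "F a b = 0" for a b by (rule fun_cong)
  then show ?thesis by (simp add: normal_form_def)
qed

lemma action_surj: "\<phi> ` carrier free_algebra = carrier (endo_algebra Z2 regular_functions)"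
proof
  show "\<phi> ` carrier free_algebra \<subseteq> carrier (endo_algebra Z2 regular_functions)"
    using hom_closed by auto
  show "carrier (endo_algebra Z2 regular_functions) \<subseteq> \<phi> ` carrier free_algebra"
  proof
    fix T :: "(bit ^ 'n \<Rightarrow> bit) \<Rightarrow> (bit ^ 'n \<Rightarrow> bit)"
    assume T: "T \<in> carrier (endo_algebra Z2 regular_functions)"
    have "\<forall>b. \<exists>c. (\<lambda>x. T (delta (x + b)) x) = reed_muller c"
      by (intro allI surjD[OF surj_reed_muller])
    \<comment> \<open>\<open>T (delta (x + b)) x\<close> is the kernel of \<open>T\<close> at \<open>x\<close> and shift \<open>b\<close>; its Reed-Muller coefficients
      in \<open>x\<close> are those of the normal form.\<close>
    from choice[OF this] obtain C where C: "(\<lambda>x. T (delta (x + b)) x) = reed_muller (C b)" for b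
      by blast
    let ?p = "normal_form (\<lambda>a b. C b a)"
    have "\<phi> ?p (delta y) x = T (delta y) x" for x y
      using fun_cong[OF C[of "x + y"], of x] by (simp add: action_normal_form_delta)
    then have "(\<Sum>y\<in>UNIV. f y * \<phi> ?p (delta y) x) = (\<Sum>y\<in>UNIV. f y * T (delta y) x)" for f x
      by (simp only:)
    then have "\<phi> ?p f x = T f x" for f x
      by (simp only: endo_regular_functions_expand[OF T, of f x]
          endo_regular_functions_expand[of "\<phi> ?p" f x, OF hom_closed] free_algebra_simps UNIV_I)
    then have "\<phi> ?p = T" by (intro ext)
    then show "T \<in> \<phi> ` carrier free_algebra" by auto
  qed
qed

lemma kernel_iff: "p \<in> a_kernel free_algebra (endo_algebra Z2 regular_functions) \<phi>
    \<longleftrightarrow> (\<forall>f x. \<phi> p f x = 0)"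
proof -
  have "\<phi> p = \<zero>\<^bsub>endo_algebra Z2 regular_functions\<^esub> \<longleftrightarrow> (\<forall>f x. \<phi> p f x = 0)"
    by (simp only: fun_eq_iff endo_regular_functions_simps)
  then show ?thesis by (simp only: a_kernel_def' mem_Collect_eq free_algebra_simps UNIV_I simp_thms)
qed

lemma sbw_ideal_annihilates:
  assumes "p \<in> sbw_ideal"
  shows "\<phi> p f x = 0"
proof -
  have shift_twice: "f (x + axis i 1 + axis i 1) = f x" for f :: "bit ^ 'n \<Rightarrow> bit" and x i
    by (simp add: add.assoc)
  have shift_swap: "f (x + axis i 1 + axis j 1) = f (x + axis j 1 + axis i 1)"
    for f :: "bit ^ 'n \<Rightarrow> bit" and x i j
    by (simp only: add.assoc add.commute[of "axis i 1"])
  have shift_coord: "(x + axis i 1) $ j = (if i = j then x $ j + 1 else x $ j)" for x :: "bit ^ 'n" and i j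
    by (simp add: axis_def)
  have bit_cases: "b * (b * c) + b * c = 0" "(b + 1) * c + b * c + c = 0" for b c :: bit
    by (cases b; simp)+
  have "\<phi> r f x = 0" if "r \<in> sbw_relations" for r f x
  proof -
    from that consider i where "r = X i ^ 2 + X i" | i where "r = S i ^ 2 + 1"
      | i where "r = S i * X i + X i * S i + S i" | i j where "r = X i * X j + X j * X i"
      | i j where "r = S i * S j + S j * S i" | i j where "i \<noteq> j" "r = S i * X j + X j * S i"
      unfolding sbw_relations_def by blast
    then show ?thesis
    proof cases
      case (1 i)
      then show ?thesis
        by (simp only: power2_eq_square action_add action_mult action_X bit_cases)
    next
      case (2 i)
      then show ?thesis
        by (simp only: power2_eq_square action_add action_mult action_S action_one shift_twice bit_add_self)
    next
      case (3 i)
      then show ?thesis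
        by (simp only: action_add action_mult action_X action_S shift_coord simp_thms if_True bit_cases)
    next
      case (4 i j)
      then show ?thesis
        by (simp only: action_add action_mult action_X mult.left_commute[of "x $ i"] bit_add_self)
    next
      case (5 i j)
      then show ?thesis
        by (simp only: action_add action_mult action_S shift_swap[of f x i] bit_add_self)
    next
      case (6 i j)
      then show ?thesis
        by (simp only: action_add action_mult action_X action_S shift_coord if_False bit_add_self)
    qed
  qed
  then have "sbw_relations \<subseteq> a_kernel free_algebra (endo_algebra Z2 regular_functions) \<phi>"
    by (auto simp only: kernel_iff)
  then have "sbw_ideal \<subseteq> a_kernel free_algebra (endo_algebra Z2 regular_functions) \<phi>"
    unfolding sbw_ideal_def by (intro R.genideal_minimal kernel_is_ideal)
  with assms kernel_iff show ?thesis by blast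
qed

text \<open>
  The relations hold for the operators, which is one inclusion. Conversely an element of the kernel
  is congruent to a normal form that also acts as zero, and such a normal form is zero.
\<close>

theorem kernel_eq_sbw_ideal:
  "a_kernel free_algebra (endo_algebra Z2 regular_functions) \<phi> = sbw_ideal"
proof
  show "sbw_ideal \<subseteq> a_kernel free_algebra (endo_algebra Z2 regular_functions) \<phi>"
    using sbw_ideal_annihilates kernel_iff by blast
  show "a_kernel free_algebra (endo_algebra Z2 regular_functions) \<phi> \<subseteq> sbw_ideal"
  proof
    fix p assume p: "p \<in> a_kernel free_algebra (endo_algebra Z2 regular_functions) \<phi>"
    obtain F where F: "p + normal_form F \<in> sbw_ideal"
      using every_has_normal_form[of p] by (auto simp: has_normal_form_def sbw_eq_def)
    have "\<phi> (normal_form F) f x = 0" for f x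
    proof -
      have "\<phi> p f x + \<phi> (normal_form F) f x = 0"
        using sbw_ideal_annihilates[OF F] by (simp only: action_add)
      moreover have "\<phi> p f x = 0" using p kernel_iff by blast
      ultimately show ?thesis by simp
    qed
    then have "normal_form F = 0" by (rule normal_form_faithful)
    with F show "p \<in> sbw_ideal" by simp
  qed
qed

end

lemma mult_op_shift_op_endo:
  "mult_op i \<in> carrier (endo_algebra Z2 regular_functions)"
  "shift_op i \<in> carrier (endo_algebra Z2 regular_functions)"
  unfolding endo_regular_functions_carrier
  by (simp_all only: mult_op_def shift_op_def regular_functions_simps restrict_UNIV coord_def
      distrib_left mult.left_commute[of "_ $ i"] simp_thms)

lemma ex1_sbw_action: "\<exists>!\<phi>. sbw_action \<phi>"
proof -
  let ?\<alpha> = "\<lambda>g. case g of Xgen i \<Rightarrow> mult_op i | Sgen i \<Rightarrow> shift_op i"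
  have gens: "(\<forall>g. \<phi> (gen g) = ?\<alpha> g) \<longleftrightarrow>
      (\<forall>i. \<phi> (gen (Xgen i)) = mult_op i) \<and> (\<forall>i. \<phi> (gen (Sgen i)) = shift_op i)" for \<phi>
    by (metis sbw_gen.case sbw_gen.exhaust)
  show ?thesis
    unfolding sbw_action_def gens[symmetric]
    by (intro free_algebra_universal module.endo_assoc_algebra regular_functions_module)
      (simp add: mult_op_shift_op_endo split: sbw_gen.split)
qed

theorem theorem26:
  shows "(\<exists>!\<phi> :: ('n::finite sbw_gen word \<Rightarrow>\<^sub>0 bit) \<Rightarrow> (bit ^ 'n \<Rightarrow> bit) \<Rightarrow> (bit ^ 'n \<Rightarrow> bit). sbw_action \<phi>) \<and>
    (\<forall>\<phi> :: ('n sbw_gen word \<Rightarrow>\<^sub>0 bit) \<Rightarrow> (bit ^ 'n \<Rightarrow> bit) \<Rightarrow> (bit ^ 'n \<Rightarrow> bit).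
      sbw_action \<phi> \<longrightarrow>
      (\<exists>\<psi>. assoc_algebra_iso Z2 SBW (endo_algebra Z2 regular_functions) \<psi> \<and>
           (\<forall>p \<in> carrier free_algebra. \<psi> (sbw_ideal +>\<^bsub>free_algebra\<^esub> p) = \<phi> p)))"
proof (intro conjI allI impI)
  show "\<exists>!\<phi> :: ('n sbw_gen word \<Rightarrow>\<^sub>0 bit) \<Rightarrow> (bit ^ 'n \<Rightarrow> bit) \<Rightarrow> (bit ^ 'n \<Rightarrow> bit). sbw_action \<phi>"
    by (rule ex1_sbw_action)
next
  fix \<phi> :: "('n sbw_gen word \<Rightarrow>\<^sub>0 bit) \<Rightarrow> (bit ^ 'n \<Rightarrow> bit) \<Rightarrow> (bit ^ 'n \<Rightarrow> bit)"
  assume "sbw_action \<phi>"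
  then interpret sbw_representation \<phi> by unfold_locales
  show "\<exists>\<psi>. assoc_algebra_iso Z2 SBW (endo_algebra Z2 regular_functions) \<psi> \<and>
      (\<forall>p \<in> carrier free_algebra. \<psi> (sbw_ideal +>\<^bsub>free_algebra\<^esub> p) = \<phi> p)"
    using assoc_algebra_hom.first_isomorphism[OF hom action_surj]
    unfolding kernel_eq_sbw_ideal SBW_def .
qed

end
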